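(* Let $I=[a,b]$ be a compact interval in $\mathbb{R}$ and let $\lambda,\kappa,\mu,\rho\ge 0$ be real numbers with $\kappa(1-\lambda\rho)\ge\mu$. Let $K: I\times I\to\mathbb{R}_+$ be a continuous map with $K(t,s)\le\rho$ for all $(t,s)\in I\times I$. Suppose that one of the following two cases holds: (1) $f\in\mathcal{F}^{lsc}_{op}(I,\mathbb{R}_+;\mu)$ and $K$ is order-preserving in each of its two variables $t$ and $s$; in this case put $\mathcal{F}=\mathcal{F}^{lsc}_{op}(I,\mathbb{R}_+;\kappa)$; (2) $f\in\mathcal{F}^{lsc}_{or}(I,\mathbb{R}_+;\mu)$ and $K$ is order-reversing in each of its two variables $t$ and $s$; in this case put $\mathcal{F}=\mathcal{F}^{lsc}_{or}(I,\mathbb{R}_+;\kappa)$. Then the set of all solutions $\phi\in\mathcal{F}$ of the Fredholm integral equation $$\phi(t)=f(t)+\lambda\int_a^b K(t,s)\phi(s)\,ds,\quad t\in I,$$ is a non-empty complete sublattice of $\mathcal{F}$. Further, this equation has a minimum solution $\phi_*$ and a maximum solution $\phi^*$ in $\mathcal{F}$, given by $$\phi_*=\inf\Big\{\phi\in\mathcal{F}: f(t)+\lambda\int_a^b K(t,s)\phi(s)\,ds\le\phi(t)\ \text{for all } t\in I\Big\},$$ $$\phi^*=\sup\Big\{\phi\in\mathcal{F}: \phi(t)\le f(t)+\lambda\int_a^b K(t,s)\phi(s)\,ds\ \text{for all } t\in I\Big\}.$$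
   Context: $\mathbb{R}_+=[0,\infty)$ with the usual order $\le$. A map $\phi:I\to\mathbb{R}_+$ is order-preserving (resp. order-reversing) if $\phi(x)\le\phi(y)$ (resp. $\phi(y)\le\phi(x)$) whenever $x\le y$ in $I$. A map $K:I\times I\to\mathbb{R}_+$ is order-preserving (resp. order-reversing) in the variable $t$ if $t\mapsto K(t,s)$ is order-preserving (resp. order-reversing) for every $s\in I$, and similarly in the variable $s$ with $t\in I$ fixed. A map $\phi:I\to\mathbb{R}$ is LSC (lower-semi-continuous) at $t_0\in I$ if for every $\epsilon>0$ there is $\delta>0$ with $\phi(t_0)-\epsilon\le\phi(t)$ for all $t\in(t_0-\delta,t_0+\delta)\cap I$; it is LSC on $I$ if it is LSC at every point of $I$. For $\kappa\ge 0$, $\mathcal{F}^{lsc}_{op}(I,\mathbb{R}_+;\kappa)$ (resp. $\mathcal{F}^{lsc}_{or}(I,\mathbb{R}_+;\kappa)$) is the set of all LSC order-preserving (resp. LSC order-reversing) maps $\phi:I\to\mathbb{R}_+$ with $\phi(t)\le\kappa$ for all $t\in I$. Each is ordered by the pointwise partial order $\trianglelefteq$: $\phi\trianglelefteq\psi$ iff $\phi(t)\le\psi(t)$ for all $t\in I$; with this order it is a complete lattice (suprema and infima of all subsets exist in it). The symbols $\inf$ and $\sup$ of sets of maps, and minimum/maximum solution, are taken in the poset $(\mathcal{F},\trianglelefteq)$. A nonempty subset $E$ of a lattice $L$ is a complete sublattice of $L$ if for every nonempty $Y\subseteq E$, $\sup_L Y$ and $\inf_L Y$ (supremum and infimum in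 $L$) exist and both belong to $E$.
   Formalization: The additional hypothesis κ(1−λρ(b−a)) ≥ μ is assumed; it is automatic when b−a ≤ 1, and without it the claim fails, e.g. on [0,2] with λ=1, ρ=1/2, κ=2, μ=1, K=1/2, f=1 there is no solution. *)

theory Defs
  imports "HOL-Analysis.Analysis" "HOL-Algebra.Complete_Lattice"
begin

definition lsc_on :: "real set \<Rightarrow> (real \<Rightarrow> real) \<Rightarrow> bool" where
  "lsc_on I \<phi> \<longleftrightarrow>
     (\<forall>t0\<in>I. \<forall>\<epsilon>>0. \<exists>\<delta>>0. \<forall>t\<in>{t0 - \<delta><..<t0 + \<delta>} \<inter> I. \<phi> t0 - \<epsilon> \<le> \<phi> t)"

text \<open>Maps on \<open>I\<close> are extensional functions (\<^term>\<open>undefined\<close> outside \<open>I\<close>), so that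
  pointwise equality on \<open>I\<close> is equality and the pointwise order is antisymmetric.\<close>

definition F_lsc_op :: "real set \<Rightarrow> real \<Rightarrow> (real \<Rightarrow> real) set" where
  "F_lsc_op I \<kappa> = {\<phi> \<in> I \<rightarrow>\<^sub>E {0..\<kappa>}. lsc_on I \<phi> \<and> mono_on I \<phi>}"

definition F_lsc_or :: "real set \<Rightarrow> real \<Rightarrow> (real \<Rightarrow> real) set" where
  "F_lsc_or I \<kappa> = {\<phi> \<in> I \<rightarrow>\<^sub>E {0..\<kappa>}. lsc_on I \<phi> \<and> antimono_on I \<phi>}"

definition pointwise_poset :: "real set \<Rightarrow> (real \<Rightarrow> real) set \<Rightarrow> (real \<Rightarrow> real) gorder" where
  "pointwise_poset I F =
     \<lparr>carrier = F, eq = (=), le = (\<lambda>\<phi> \<psi>. \<forall>t\<in>I. \<phi> t \<le> \<psi> t)\<rparr>"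

text \<open>The bounds in the next definition are those of \<open>L\<close>, not of the poset induced on \<open>E\<close>.\<close>

definition complete_sublattice :: "('a, 'm) gorder_scheme \<Rightarrow> 'a set \<Rightarrow> bool" where
  "complete_sublattice L E \<longleftrightarrow>
     lattice L \<and> E \<noteq> {} \<and> E \<subseteq> carrier L \<and>
     (\<forall>Y. Y \<noteq> {} \<and> Y \<subseteq> E \<longrightarrow> (\<exists>s\<in>E. is_lub L s Y) \<and> (\<exists>i\<in>E. is_glb L i Y))"

definition fredholm_rhs ::
  "real \<Rightarrow> real \<Rightarrow> real \<Rightarrow> (real \<Rightarrow> real \<Rightarrow> real) \<Rightarrow> (real \<Rightarrow> real) \<Rightarrow> (real \<Rightarrow> real) \<Rightarrow> real \<Rightarrow> real" where
  "fredholm_rhs a b lam K f \<phi> t = f t + lam * integral {a..b} (\<lambda>s. K t s * \<phi> s)"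

text \<open>The hypothesis \<open>\<kappa> (1 - \<lambda> \<rho>) \<ge> \<mu>\<close> bounds the right-hand side by \<open>\<kappa>\<close> only if
  \<open>b - a \<le> 1\<close>. On \<open>[0, 2]\<close> with \<open>\<lambda> = 1\<close>, \<open>\<rho> = 1/2\<close>, \<open>\<kappa> = 2\<close>, \<open>\<mu> = 1\<close>, \<open>K = 1/2\<close> and
  \<open>f = 1\<close> it holds, but the equation has no solution at all. The theorem therefore also
  assumes \<open>\<kappa> (1 - \<lambda> \<rho> (b - a)) \<ge> \<mu>\<close>, which is automatic when \<open>b - a \<le> 1\<close>.\<close>

lemma no_solution_on_long_interval:
  "\<nexists>\<phi>. \<forall>t\<in>{0..2}. \<phi> t = fredholm_rhs 0 2 1 (\<lambda>_ _. 1/2) (\<lambda>_. 1) \<phi> t"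
proof
  assume "\<exists>\<phi>. \<forall>t\<in>{0..2}. \<phi> t = fredholm_rhs 0 2 1 (\<lambda>_ _. 1/2) (\<lambda>_. 1) \<phi> t"
  then obtain \<phi> :: "real \<Rightarrow> real" where
    \<phi>: "\<And>t. t \<in> {0..2} \<Longrightarrow> \<phi> t = 1 + integral {0..2} (\<lambda>s. 1/2 * \<phi> s)"
    unfolding fredholm_rhs_def mult_1 by metis
  define c where "c = 1 + integral {0..2} (\<lambda>s. 1/2 * \<phi> s)"
  have "integral {0..2} (\<lambda>s. 1/2 * \<phi> s) = integral {0..2::real} (\<lambda>_. 1/2 * c)"
    by (rule Henstock_Kurzweil_Integration.integral_cong) (simp only: \<phi> c_def)
  also have "\<dots> = c" by simp
  finally show False by (simp only: c_def)
qed

lemma length_hypothesis_automatic: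
  fixes a b \<kappa> lam \<mu> \<rho> :: real
  assumes "lam \<ge> 0" "\<kappa> \<ge> 0" "\<rho> \<ge> 0" "\<kappa> * (1 - lam * \<rho>) \<ge> \<mu>" "b - a \<le> 1"
  shows "\<kappa> * (1 - lam * \<rho> * (b - a)) \<ge> \<mu>"
proof -
  have "lam * \<rho> * (b - a) \<le> lam * \<rho> * 1"
    using assms by (intro mult_left_mono) auto
  then have "\<kappa> * (1 - lam * \<rho>) \<le> \<kappa> * (1 - lam * \<rho> * (b - a))"
    using assms by (intro mult_left_mono) auto
  then show ?thesis using assms by linarith
qed

end

theory Submission
  imports Defs
begin

text \<open>
  Write \<open>q = \<lambda>\<rho>(b - a)\<close>. The hypothesis \<open>\<kappa>(1 - q) \<ge> \<mu>\<close> makes the right-hand side of the equation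
  bounded by \<open>\<kappa>\<close> for \<open>\<phi> \<le> \<kappa>\<close>. Since \<open>f\<close> is lower semicontinuous and the integral term depends
  continuously on \<open>t\<close>, the right-hand side defines an isotone self-map of the lattice \<open>F\<close>. As \<open>F\<close> is a
  complete lattice (\<open>complete_lattice_F_lsc\<close>), the Knaster-Tarski theorem provides the least and
  the greatest solution together with the formulas for them.

  Tarski's theorem only makes the solutions a complete lattice in the induced order. They form a
  complete \<^emph>\<open>sublattice\<close> because there are so few of them (\<open>solutions_unique_or_constants\<close>): either
  there is exactly one, or they are exactly the constants in \<open>[0, \<kappa>]\<close>. The reason is a maximum
  principle (\<open>homogeneous_solution_constant_modulus\<close>). If \<open>\<kappa> > 0\<close>, then \<open>q \<le> 1\<close>. A solution \<open>d\<close> of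
  the homogeneous equation is continuous, and at a maximum point of \<open>|d|\<close> one finds
  \<open>max |d| \<le> \<lambda>\<rho> \<integral>|d| \<le> q max |d|\<close>, so \<open>d = 0\<close> unless \<open>q = 1\<close>, in which case \<open>|d|\<close> is
  constant. For \<open>q < 1\<close> this applies to the difference of two solutions. For \<open>q = 1\<close> the hypothesis
  forces \<open>\<mu> = 0\<close> and hence \<open>f = 0\<close>, so that it applies to each solution by itself, and by
  linearity one nonzero constant solution makes all constants solutions. If \<open>\<kappa> = 0\<close>, then \<open>F\<close>
  contains only the zero map.
\<close>

section \<open>The lattice of bounded monotone lower semicontinuous maps\<close>

text \<open>The parameter \<open>R\<close> is \<open>\<le>\<close> for order-preserving and \<open>\<ge>\<close> for order-reversing maps, so that
  both cases of the theorem are treated at once.\<close>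

definition F_lsc :: "(real \<Rightarrow> real \<Rightarrow> bool) \<Rightarrow> real set \<Rightarrow> real \<Rightarrow> (real \<Rightarrow> real) set" where
  "F_lsc R I \<kappa> = {\<phi> \<in> I \<rightarrow>\<^sub>E {0..\<kappa>}. lsc_on I \<phi> \<and> monotone_on I (\<le>) R \<phi>}"

lemma F_lsc_op_eq: "F_lsc_op I \<kappa> = F_lsc (\<le>) I \<kappa>"
  by (simp add: F_lsc_def F_lsc_op_def)

lemma F_lsc_or_eq: "F_lsc_or I \<kappa> = F_lsc (\<ge>) I \<kappa>"
  by (simp add: F_lsc_def F_lsc_or_def)

lemma carrier_pointwise_poset [simp]: "carrier (pointwise_poset I F) = F"
  and le_pointwise_poset [simp]: "le (pointwise_poset I F) \<phi> \<psi> \<longleftrightarrow> (\<forall>t\<in>I. \<phi> t \<le> \<psi> t)"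
  and eq_pointwise_poset [simp]: "eq (pointwise_poset I F) = (=)"
  by (simp_all add: pointwise_poset_def)

lemma partial_order_pointwise_poset:
  assumes "F \<subseteq> extensional I"
  shows "partial_order (pointwise_poset I F)"
proof
  fix \<phi> \<psi>
  assume "\<phi> \<sqsubseteq>\<^bsub>pointwise_poset I F\<^esub> \<psi>" "\<psi> \<sqsubseteq>\<^bsub>pointwise_poset I F\<^esub> \<phi>"
    "\<phi> \<in> carrier (pointwise_poset I F)" "\<psi> \<in> carrier (pointwise_poset I F)"
  then have "\<phi> = \<psi>"
    using assms by (intro extensionalityI[of \<phi> I]) (auto intro: order.antisym)
  then show "\<phi> .=\<^bsub>pointwise_poset I F\<^esub> \<psi>" by simp
qed (auto intro: order_trans)

text \<open>At \<open>t0\<close> a single member of the family comes within \<open>\<epsilon>/2\<close> of the supremum; near \<open>t0\<close> it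
  loses at most another \<open>\<epsilon>/2\<close>, and the supremum dominates it.\<close>

lemma lsc_on_SUP:
  assumes "Y \<noteq> {}" and bdd: "\<And>t. t \<in> I \<Longrightarrow> bdd_above ((\<lambda>\<phi>. \<phi> t) ` Y)"
    and lsc: "\<And>\<phi>. \<phi> \<in> Y \<Longrightarrow> lsc_on I \<phi>"
  shows "lsc_on I (\<lambda>t\<in>I. SUP \<phi>\<in>Y. \<phi> t)"
  unfolding lsc_on_def
proof (intro ballI allI impI)
  fix t0 \<epsilon> :: real assume t0: "t0 \<in> I" and "\<epsilon> > 0"
  then have "(SUP \<phi>\<in>Y. \<phi> t0) - \<epsilon>/2 < (SUP \<phi>\<in>Y. \<phi> t0)" by simp
  then obtain \<phi> where \<phi>: "\<phi> \<in> Y" "(SUP \<phi>\<in>Y. \<phi> t0) - \<epsilon>/2 < \<phi> t0"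
    using less_cSUP_iff[OF \<open>Y \<noteq> {}\<close> bdd[OF t0]] by blast
  obtain \<delta> where "\<delta> > 0" and \<delta>: "\<forall>t\<in>{t0-\<delta><..<t0+\<delta>} \<inter> I. \<phi> t0 - \<epsilon>/2 \<le> \<phi> t"
    using lsc[OF \<phi>(1)] t0 \<open>\<epsilon> > 0\<close> unfolding lsc_on_def by (meson half_gt_zero)
  have "(\<lambda>t\<in>I. SUP \<phi>\<in>Y. \<phi> t) t0 - \<epsilon> \<le> (\<lambda>t\<in>I. SUP \<phi>\<in>Y. \<phi> t) t"
    if "t \<in> {t0-\<delta><..<t0+\<delta>} \<inter> I" for t
  proof -
    have "\<phi> t \<le> (SUP \<phi>\<in>Y. \<phi> t)"
      using that by (intro cSUP_upper \<phi> bdd) auto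
    then show ?thesis
      using \<delta>[rule_format, OF that] \<phi>(2) t0 that by simp
  qed
  then show "\<exists>\<delta>>0. \<forall>t\<in>{t0-\<delta><..<t0+\<delta>} \<inter> I.
      (\<lambda>t\<in>I. SUP \<phi>\<in>Y. \<phi> t) t0 - \<epsilon> \<le> (\<lambda>t\<in>I. SUP \<phi>\<in>Y. \<phi> t) t"
    using \<open>\<delta> > 0\<close> by blast
qed

lemma const_in_F_lsc:
  assumes "R = (\<le>) \<or> R = (\<ge>)" "c \<in> {0..\<kappa>}"
  shows "(\<lambda>t\<in>I. c) \<in> F_lsc R I \<kappa>"
  using assms by (auto simp: F_lsc_def lsc_on_def monotone_on_def intro!: exI[of _ 1])

lemma SUP_in_F_lsc:
  assumes R: "R = (\<le>) \<or> R = (\<ge>)" and Y: "Y \<noteq> {}" "Y \<subseteq> F_lsc R I \<kappa>"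
  shows "(\<lambda>t\<in>I. SUP \<phi>\<in>Y. \<phi> t) \<in> F_lsc R I \<kappa>"
proof -
  have bd: "0 \<le> \<phi> t \<and> \<phi> t \<le> \<kappa>" if "\<phi> \<in> Y" "t \<in> I" for \<phi> t
    using Y that by (force simp: F_lsc_def PiE_iff)
  have bdd: "bdd_above ((\<lambda>\<phi>. \<phi> t) ` Y)" if "t \<in> I" for t
    using bd that by (auto intro!: bdd_aboveI2)
  have "lsc_on I (\<lambda>t\<in>I. SUP \<phi>\<in>Y. \<phi> t)"
    using Y bdd by (intro lsc_on_SUP) (auto simp: F_lsc_def)
  moreover have "(SUP \<phi>\<in>Y. \<phi> t) \<in> {0..\<kappa>}" if "t \<in> I" for t
  proof -
    obtain \<phi> where "\<phi> \<in> Y" using Y by blast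
    then have "0 \<le> (SUP \<phi>\<in>Y. \<phi> t)"
      using bd bdd that by (meson cSUP_upper2)
    moreover have "(SUP \<phi>\<in>Y. \<phi> t) \<le> \<kappa>"
      using bd that Y by (intro cSUP_least) auto
    ultimately show ?thesis by simp
  qed
  moreover have "monotone_on I (\<le>) R (\<lambda>t\<in>I. SUP \<phi>\<in>Y. \<phi> t)"
  proof (rule monotone_onI)
    fix s t assume st: "s \<in> I" "t \<in> I" "s \<le> t"
    have m: "R (\<phi> s) (\<phi> t)" if "\<phi> \<in> Y" for \<phi>
      using Y st that by (auto simp: F_lsc_def monotone_on_def)
    show "R ((\<lambda>t\<in>I. SUP \<phi>\<in>Y. \<phi> t) s) ((\<lambda>t\<in>I. SUP \<phi>\<in>Y. \<phi> t) t)"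
      using R m st Y bdd by (auto intro!: cSUP_mono)
  qed
  ultimately show ?thesis by (auto simp: F_lsc_def)
qed

lemma complete_lattice_F_lsc:
  assumes R: "R = (\<le>) \<or> R = (\<ge>)" and "\<kappa> \<ge> 0"
  shows "complete_lattice (pointwise_poset I (F_lsc R I \<kappa>))" (is "complete_lattice ?L")
proof -
  interpret partial_order ?L
    by (rule partial_order_pointwise_poset) (auto simp: F_lsc_def PiE_def)
  have sup_ex: "\<exists>s. is_lub ?L s Y" if "Y \<subseteq> carrier ?L" for Y
  proof -
    \<comment> \<open>Adding the bottom element changes no upper bound and covers the empty family.\<close>
    let ?Z = "insert (\<lambda>t\<in>I. 0) Y"
    have Z: "?Z \<subseteq> F_lsc R I \<kappa>"
      using that const_in_F_lsc[OF R, of 0 \<kappa> I] \<open>\<kappa> \<ge> 0\<close> by auto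
    have bdd: "bdd_above ((\<lambda>\<phi>. \<phi> t) ` ?Z)" if "t \<in> I" for t
      using Z that unfolding F_lsc_def by (intro bdd_aboveI2[of _ _ \<kappa>]) (force simp: PiE_iff)
    have "is_lub ?L (\<lambda>t\<in>I. SUP \<phi>\<in>?Z. \<phi> t) Y"
    proof (rule least_UpperI)
      fix \<phi> assume "\<phi> \<in> Y"
      then show "\<phi> \<sqsubseteq>\<^bsub>?L\<^esub> (\<lambda>t\<in>I. SUP \<phi>\<in>?Z. \<phi> t)"
        using bdd by (auto simp del: image_insert intro!: cSUP_upper)
    next
      fix \<psi> assume \<psi>: "\<psi> \<in> Upper ?L Y"
      have "\<phi> t \<le> \<psi> t" if "\<phi> \<in> ?Z" "t \<in> I" for \<phi> t
        using that \<psi> Z by (auto simp: Upper_def F_lsc_def PiE_iff)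
      then show "(\<lambda>t\<in>I. SUP \<phi>\<in>?Z. \<phi> t) \<sqsubseteq>\<^bsub>?L\<^esub> \<psi>"
        by (auto simp del: image_insert intro!: cSUP_least)
    qed (use that SUP_in_F_lsc[OF R _ Z] in auto)
    then show ?thesis by blast
  qed
  show ?thesis
  proof (rule complete_latticeI)
    fix Y assume Y: "Y \<subseteq> carrier ?L"
    then show "\<exists>s. is_lub ?L s Y" by (rule sup_ex)
    \<comment> \<open>Pointwise infima need not be lower semicontinuous, so the infimum is taken as the
      supremum of the lower bounds.\<close>
    obtain s where s: "is_lub ?L s (Lower ?L Y)"
      using sup_ex[OF Lower_closed] by blast
    have "is_glb ?L s Y"
    proof (rule greatest_LowerI)
      show "s \<sqsubseteq>\<^bsub>?L\<^esub> \<phi>" if "\<phi> \<in> Y" for \<phi>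
        using that Y by (intro least_le[OF s]) (auto simp: Upper_def Lower_def)
      show "\<psi> \<sqsubseteq>\<^bsub>?L\<^esub> s" if "\<psi> \<in> Lower ?L Y" for \<psi>
        using that by (intro least_Upper_above[OF s] Lower_closed) auto
    qed (use Y least_closed[OF s] in auto)
    then show "\<exists>i. is_glb ?L i Y" by blast
  qed
qed

section \<open>Integral operators with a continuous kernel\<close>

text \<open>Members of \<open>F\<close> need not be continuous; monotonicity is what makes them integrable.\<close>

lemma monotone_on_absolutely_integrable:
  fixes \<phi> :: "real \<Rightarrow> real"
  assumes R: "R = (\<le>) \<or> R = (\<ge>)" and mono: "monotone_on {a..b} (\<le>) R \<phi>"
  shows "\<phi> absolutely_integrable_on {a..b}"
proof -
  have "integrable (lebesgue_on {a..b}) \<phi>"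
    using R
  proof
    assume "R = (\<le>)"
    then show ?thesis using mono integrable_mono_on by simp
  next
    assume "R = (\<ge>)"
    then have "mono_on {a..b} (\<lambda>s. - \<phi> s)"
      using mono by (auto simp: monotone_on_def)
    then have "integrable (lebesgue_on {a..b}) (\<lambda>s. - \<phi> s)"
      by (rule integrable_mono_on)
    then show ?thesis by simp
  qed
  then show ?thesis by (simp add: set_integrable_def integrable_restrict_space)
qed

lemma kernel_product_absolutely_integrable:
  fixes K :: "real \<Rightarrow> real \<Rightarrow> real"
  assumes contK: "continuous_on ({a..b} \<times> {a..b}) (\<lambda>(t, s). K t s)"
    and \<phi>: "\<phi> absolutely_integrable_on {a..b}" and t: "t \<in> {a..b}"
  shows "(\<lambda>s. K t s * \<phi> s) absolutely_integrable_on {a..b}"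
proof -
  have "continuous_on {a..b} (\<lambda>s. case (t, s) of (t, s) \<Rightarrow> K t s)"
    by (rule continuous_on_compose2[OF contK]) (use t in \<open>auto intro!: continuous_intros\<close>)
  then have c: "continuous_on {a..b} (K t)" by simp
  show ?thesis
  proof (rule absolutely_integrable_bounded_measurable_product_real[OF _ _ _ \<phi>])
    show "K t \<in> borel_measurable (lebesgue_on {a..b})"
      using c by (intro continuous_imp_measurable_on_sets_lebesgue) auto
    show "bounded (K t ` {a..b})"
      using c by (intro compact_imp_bounded compact_continuous_image) auto
  qed auto
qed

text \<open>Uniform continuity of \<open>K\<close> makes \<open>\<integral>|K(u,s) - K(t,s)| |\<phi>(s)| ds\<close> small with \<open>|u - t|\<close>,
  whatever the regularity of \<open>\<phi>\<close>.\<close>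

lemma continuous_on_integral_operator:
  fixes K :: "real \<Rightarrow> real \<Rightarrow> real"
  assumes contK: "continuous_on ({a..b} \<times> {a..b}) (\<lambda>(t, s). K t s)"
    and \<phi>: "\<phi> absolutely_integrable_on {a..b}"
  shows "continuous_on {a..b} (\<lambda>t. integral {a..b} (\<lambda>s. K t s * \<phi> s))"
  unfolding continuous_on_iff
proof (intro ballI allI impI)
  fix t \<epsilon> :: real assume t: "t \<in> {a..b}" and "\<epsilon> > 0"
  define C where "C = integral {a..b} (\<lambda>s. \<bar>\<phi> s\<bar>)"
  have int_abs: "(\<lambda>s. \<bar>\<phi> s\<bar>) integrable_on {a..b}"
    using \<phi> by (simp add: absolutely_integrable_on_def)
  have "C \<ge> 0" unfolding C_def by (rule integral_nonneg[OF int_abs]) auto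
  have ucK: "uniformly_continuous_on ({a..b} \<times> {a..b}) (\<lambda>(t, s). K t s)"
    using contK by (intro compact_uniformly_continuous compact_Times) auto
  \<comment> \<open>Dividing by \<open>C + 1\<close> rather than \<open>C\<close> allows for \<open>C = 0\<close>.\<close>
  have "\<epsilon> / (C + 1) > 0" using \<open>\<epsilon> > 0\<close> \<open>C \<ge> 0\<close> by simp
  then obtain \<delta> where "\<delta> > 0" and \<delta>: "\<And>p q. p \<in> {a..b} \<times> {a..b} \<Longrightarrow> q \<in> {a..b} \<times> {a..b} \<Longrightarrow>
      dist q p < \<delta> \<Longrightarrow> dist (case q of (t, s) \<Rightarrow> K t s) (case p of (t, s) \<Rightarrow> K t s) < \<epsilon> / (C + 1)"
    using ucK unfolding uniformly_continuous_on_def by meson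
  have "dist (integral {a..b} (\<lambda>s. K u s * \<phi> s)) (integral {a..b} (\<lambda>s. K t s * \<phi> s)) < \<epsilon>"
    if u: "u \<in> {a..b}" "dist u t < \<delta>" for u
  proof -
    have K: "\<bar>K u s - K t s\<bar> \<le> \<epsilon> / (C + 1)" if "s \<in> {a..b}" for s
      using \<delta>[of "(t, s)" "(u, s)"] t u that by (auto simp: dist_Pair_Pair dist_real_def)
    have int: "(\<lambda>s. K v s * \<phi> s) integrable_on {a..b}" if "v \<in> {a..b}" for v
      using kernel_product_absolutely_integrable[OF contK \<phi> that]
      by (simp add: absolutely_integrable_on_def)
    have "dist (integral {a..b} (\<lambda>s. K u s * \<phi> s)) (integral {a..b} (\<lambda>s. K t s * \<phi> s))
        = norm (integral {a..b} (\<lambda>s. K u s * \<phi> s - K t s * \<phi> s))"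
      using int u t by (simp add: dist_norm integral_diff)
    also have "\<dots> \<le> integral {a..b} (\<lambda>s. \<epsilon> / (C + 1) * \<bar>\<phi> s\<bar>)"
    proof (rule integral_norm_bound_integral)
      show "norm (K u s * \<phi> s - K t s * \<phi> s) \<le> \<epsilon> / (C + 1) * \<bar>\<phi> s\<bar>" if "s \<in> {a..b}" for s
        using mult_right_mono[OF K[OF that], of "\<bar>\<phi> s\<bar>"]
        by (simp add: left_diff_distrib[symmetric] abs_mult)
    qed (intro integrable_diff int u t integrable_on_mult_right int_abs)+
    also have "\<dots> = \<epsilon> / (C + 1) * C" by (simp add: C_def)
    also have "\<dots> < \<epsilon>" using \<open>\<epsilon> > 0\<close> \<open>C \<ge> 0\<close> by (simp add: field_simps)
    finally show ?thesis .
  qed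
  then show "\<exists>\<delta>>0. \<forall>u\<in>{a..b}. dist u t < \<delta> \<longrightarrow>
      dist (integral {a..b} (\<lambda>s. K u s * \<phi> s)) (integral {a..b} (\<lambda>s. K t s * \<phi> s)) < \<epsilon>"
    using \<open>\<delta> > 0\<close> by blast
qed

text \<open>The maximum principle. With \<open>M\<close> the maximum of \<open>|d|\<close>, the equation at a maximum point gives
  \<open>M \<le> \<lambda>\<rho> \<integral>|d| \<le> \<lambda>\<rho>(b - a) M \<le> M\<close>. If \<open>M > 0\<close>, equality holds throughout, so the nonnegative
  continuous function \<open>M - |d|\<close> has integral zero and vanishes.\<close>

lemma homogeneous_solution_constant_modulus:
  fixes K :: "real \<Rightarrow> real \<Rightarrow> real"
  assumes "a \<le> b" "lam \<ge> 0" and q: "lam * \<rho> * (b - a) \<le> 1"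
    and contK: "continuous_on ({a..b} \<times> {a..b}) (\<lambda>(t, s). K t s)"
    and K: "\<forall>t\<in>{a..b}. \<forall>s\<in>{a..b}. \<bar>K t s\<bar> \<le> \<rho>"
    and d: "d absolutely_integrable_on {a..b}"
    and d_eq: "\<And>t. t \<in> {a..b} \<Longrightarrow> d t = lam * integral {a..b} (\<lambda>s. K t s * d s)"
  obtains M where "\<And>t. t \<in> {a..b} \<Longrightarrow> \<bar>d t\<bar> = M" "M = 0 \<or> lam * \<rho> * (b - a) = 1"
proof -
  have contd: "continuous_on {a..b} d"
    by (subst continuous_on_cong[OF refl d_eq])
      (auto intro!: continuous_intros continuous_on_integral_operator contK d)
  then have cont_abs: "continuous_on {a..b} (\<lambda>s. \<bar>d s\<bar>)" by (intro continuous_intros)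
  then obtain t0 where t0: "t0 \<in> {a..b}" and max: "\<And>t. t \<in> {a..b} \<Longrightarrow> \<bar>d t\<bar> \<le> \<bar>d t0\<bar>"
    using continuous_attains_sup[of "{a..b}" "\<lambda>s. \<bar>d s\<bar>"] \<open>a \<le> b\<close> by auto
  define M where "M = \<bar>d t0\<bar>"
  have int_abs: "(\<lambda>s. \<bar>d s\<bar>) integrable_on {a..b}"
    using d by (simp add: absolutely_integrable_on_def)
  have "\<rho> \<ge> 0" using K t0 abs_ge_zero order_trans by blast
  have "\<bar>integral {a..b} (\<lambda>s. K t0 s * d s)\<bar> \<le> integral {a..b} (\<lambda>s. \<rho> * \<bar>d s\<bar>)"
  proof -
    have "norm (integral {a..b} (\<lambda>s. K t0 s * d s)) \<le> integral {a..b} (\<lambda>s. \<rho> * \<bar>d s\<bar>)"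
      using kernel_product_absolutely_integrable[OF contK d t0] int_abs K t0
      by (intro integral_norm_bound_integral)
        (auto simp: absolutely_integrable_on_def abs_mult intro!: mult_right_mono integrable_on_mult_right)
    then show ?thesis by simp
  qed
  then have le: "M \<le> lam * \<rho> * integral {a..b} (\<lambda>s. \<bar>d s\<bar>)"
    unfolding M_def using d_eq[OF t0] mult_left_mono[OF _ \<open>lam \<ge> 0\<close>] \<open>lam \<ge> 0\<close>
    by (fastforce simp: abs_mult mult.assoc)
  have "integral {a..b} (\<lambda>s. \<bar>d s\<bar>) \<le> integral {a..b} (\<lambda>s. M)"
    using max int_abs by (intro integral_le) (auto simp: M_def)
  then have le': "integral {a..b} (\<lambda>s. \<bar>d s\<bar>) \<le> M * (b - a)"
    using \<open>a \<le> b\<close> by (simp add: mult.commute)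
  show thesis
  proof (cases "M = 0")
    case True
    then show thesis using max that[of 0] by (force simp: M_def)
  next
    case False
    then have "M > 0" by (simp add: M_def)
    have "M \<le> lam * \<rho> * (M * (b - a))"
      using le le' mult_left_mono[OF le', of "lam * \<rho>"] \<open>lam \<ge> 0\<close> \<open>\<rho> \<ge> 0\<close> by simp
    then have "M * 1 \<le> M * (lam * \<rho> * (b - a))" by (simp add: mult_ac)
    then have q1: "lam * \<rho> * (b - a) = 1"
      using q \<open>M > 0\<close> by (simp add: mult_le_cancel_left)
    then have "a < b" using \<open>a \<le> b\<close> by (cases "a = b") auto
    have pos: "lam * \<rho> > 0" using q1 \<open>lam \<ge> 0\<close> \<open>\<rho> \<ge> 0\<close> by (cases "lam * \<rho> = 0") (auto simp: less_le)
    have "lam * \<rho> * (M * (b - a)) \<le> lam * \<rho> * integral {a..b} (\<lambda>s. \<bar>d s\<bar>)"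
      using le q1 by (metis mult.assoc mult.commute mult.right_neutral)
    then have "integral {a..b} (\<lambda>s. \<bar>d s\<bar>) = M * (b - a)"
      using pos le' by (simp add: mult_le_cancel_left)
    then have "integral {a..b} (\<lambda>s. M - \<bar>d s\<bar>) = 0"
      using int_abs \<open>a < b\<close> by (subst integral_diff) (auto simp: mult.commute)
    then have "\<forall>t\<in>{a..b}. M - \<bar>d t\<bar> = 0"
      using \<open>a < b\<close> max cont_abs
      by (subst (asm) integral_eq_0_iff) (auto simp: M_def intro!: continuous_intros)
    then show thesis using that[of M] q1 by force
  qed
qed

section \<open>The Fredholm equation\<close>

locale monotone_fredholm =
  fixes a b lam \<kappa> \<mu> \<rho> :: real
    and K :: "real \<Rightarrow> real \<Rightarrow> real"
    and f :: "real \<Rightarrow> real"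
    and R :: "real \<Rightarrow> real \<Rightarrow> bool"
  assumes ab: "a \<le> b" and lam: "lam \<ge> 0" and \<kappa>: "\<kappa> \<ge> 0" and \<mu>: "\<mu> \<ge> 0"
    and length_bound: "\<kappa> * (1 - lam * \<rho> * (b - a)) \<ge> \<mu>"
    and contK: "continuous_on ({a..b} \<times> {a..b}) (\<lambda>(t, s). K t s)"
    and K: "\<And>t s. t \<in> {a..b} \<Longrightarrow> s \<in> {a..b} \<Longrightarrow> 0 \<le> K t s \<and> K t s \<le> \<rho>"
    and R: "R = (\<le>) \<or> R = (\<ge>)"
    and f: "f \<in> F_lsc R {a..b} \<mu>"
    and K_mono: "\<And>s. s \<in> {a..b} \<Longrightarrow> monotone_on {a..b} (\<le>) R (\<lambda>t. K t s)"
begin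

abbreviation "I \<equiv> {a..b}"
abbreviation "F \<equiv> F_lsc R I \<kappa>"
abbreviation "L \<equiv> pointwise_poset I F"
abbreviation "rhs \<equiv> fredholm_rhs a b lam K f"

definition "solutions = {\<phi> \<in> F. \<forall>t\<in>I. \<phi> t = rhs \<phi> t}"

sublocale L: complete_lattice L
  by (rule complete_lattice_F_lsc[OF R \<kappa>])

lemma F_bounds: "\<phi> \<in> F \<Longrightarrow> t \<in> I \<Longrightarrow> 0 \<le> \<phi> t \<and> \<phi> t \<le> \<kappa>"
  by (force simp: F_lsc_def PiE_iff)

lemma F_eqI: "\<phi> \<in> F \<Longrightarrow> \<psi> \<in> F \<Longrightarrow> (\<And>t. t \<in> I \<Longrightarrow> \<phi> t = \<psi> t) \<Longrightarrow> \<phi> = \<psi>"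
  by (auto simp: F_lsc_def PiE_def intro: extensionalityI)

lemma F_absolutely_integrable: "\<phi> \<in> F \<Longrightarrow> \<phi> absolutely_integrable_on I"
  by (rule monotone_on_absolutely_integrable[OF R]) (simp add: F_lsc_def)

lemma F_kernel_integrable: "\<phi> \<in> F \<Longrightarrow> t \<in> I \<Longrightarrow> (\<lambda>s. K t s * \<phi> s) integrable_on I"
  using kernel_product_absolutely_integrable[OF contK F_absolutely_integrable]
  by (simp add: absolutely_integrable_on_def)

lemma f_bounds: "t \<in> I \<Longrightarrow> 0 \<le> f t \<and> f t \<le> \<mu>"
  using f by (force simp: F_lsc_def PiE_iff)

lemma rhs_mono:
  assumes "\<phi> \<in> F" "\<psi> \<in> F" "\<forall>t\<in>I. \<phi> t \<le> \<psi> t" "t \<in> I"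
  shows "rhs \<phi> t \<le> rhs \<psi> t"
proof -
  have "integral I (\<lambda>s. K t s * \<phi> s) \<le> integral I (\<lambda>s. K t s * \<psi> s)"
    using assms K F_kernel_integrable by (intro integral_le) (auto intro!: mult_left_mono)
  then show ?thesis using lam by (auto simp: fredholm_rhs_def intro!: mult_left_mono)
qed

lemma rhs_bounds:
  assumes "\<phi> \<in> F" "t \<in> I"
  shows "0 \<le> rhs \<phi> t \<and> rhs \<phi> t \<le> \<kappa>"
proof -
  have "0 \<le> integral I (\<lambda>s. K t s * \<phi> s)"
    using assms K F_bounds by (intro integral_nonneg F_kernel_integrable) auto
  moreover have "integral I (\<lambda>s. K t s * \<phi> s) \<le> integral I (\<lambda>s. \<rho> * \<kappa>)"
    using assms K F_bounds order_trans[of 0 "K t t" \<rho>] 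
    by (intro integral_le F_kernel_integrable) (auto intro!: mult_mono)
  then have "lam * integral I (\<lambda>s. K t s * \<phi> s) \<le> lam * (\<rho> * \<kappa> * (b - a))"
    using ab lam by (intro mult_left_mono) (auto simp: mult_ac)
  ultimately show ?thesis
    using f_bounds[OF assms(2)] length_bound lam
    by (auto simp: fredholm_rhs_def algebra_simps)
qed

text \<open>The right-hand side is the lower semicontinuous \<open>f\<close> plus a continuous function of \<open>t\<close>.\<close>

lemma rhs_lsc:
  assumes "\<phi> \<in> F"
  shows "lsc_on I (restrict (rhs \<phi>) I)"
  unfolding lsc_on_def
proof (intro ballI allI impI)
  fix t0 \<epsilon> :: real assume t0: "t0 \<in> I" and "\<epsilon> > 0"
  define g where "g t = lam * integral I (\<lambda>s. K t s * \<phi> s)" for t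
  have "continuous_on I g"
    unfolding g_def
    by (intro continuous_intros continuous_on_integral_operator contK F_absolutely_integrable assms)
  then obtain \<delta>1 where \<delta>1: "\<delta>1 > 0" "\<And>t. t \<in> I \<Longrightarrow> dist t t0 < \<delta>1 \<Longrightarrow> dist (g t) (g t0) < \<epsilon>/2"
    using t0 \<open>\<epsilon> > 0\<close> unfolding continuous_on_iff by (meson half_gt_zero)
  have "lsc_on I f" using f by (simp add: F_lsc_def)
  then obtain \<delta>2 where \<delta>2: "\<delta>2 > 0" "\<forall>t\<in>{t0-\<delta>2<..<t0+\<delta>2} \<inter> I. f t0 - \<epsilon>/2 \<le> f t"
    using t0 \<open>\<epsilon> > 0\<close> unfolding lsc_on_def by (meson half_gt_zero)
  have "restrict (rhs \<phi>) I t0 - \<epsilon> \<le> restrict (rhs \<phi>) I t"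
    if "t \<in> {t0 - min \<delta>1 \<delta>2<..<t0 + min \<delta>1 \<delta>2} \<inter> I" for t
  proof -
    have "dist t t0 < \<delta>1" "t \<in> {t0-\<delta>2<..<t0+\<delta>2} \<inter> I"
      using that by (auto simp: dist_real_def)
    then have "dist (g t) (g t0) < \<epsilon>/2" "f t0 - \<epsilon>/2 \<le> f t"
      using \<delta>1(2) \<delta>2(2) by auto
    then show ?thesis
      using t0 that by (simp add: fredholm_rhs_def g_def dist_real_def abs_if split: if_splits)
  qed
  then show "\<exists>\<delta>>0. \<forall>t\<in>{t0-\<delta><..<t0+\<delta>} \<inter> I. restrict (rhs \<phi>) I t0 - \<epsilon> \<le> restrict (rhs \<phi>) I t"
    using \<delta>1(1) \<delta>2(1) by (intro exI[of _ "min \<delta>1 \<delta>2"]) auto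
qed

text \<open>Since \<open>\<phi> \<ge> 0\<close>, monotonicity of \<open>K\<close> in \<open>t\<close> passes to the integral.\<close>

lemma rhs_in_F:
  assumes "\<phi> \<in> F"
  shows "restrict (rhs \<phi>) I \<in> F"
proof -
  have "R (rhs \<phi> s) (rhs \<phi> t)" if st: "s \<in> I" "t \<in> I" "s \<le> t" for s t
  proof -
    have Rf: "R (f s) (f t)" using f st by (auto simp: F_lsc_def monotone_on_def)
    have RK: "R (K s u) (K t u)" if "u \<in> I" for u
      using K_mono[OF that] st by (auto simp: monotone_on_def)
    have mono: "integral I (\<lambda>u. K p u * \<phi> u) \<le> integral I (\<lambda>u. K q u * \<phi> u)"
      if "p \<in> I" "q \<in> I" "\<And>u. u \<in> I \<Longrightarrow> K p u \<le> K q u" for p q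
      using that F_bounds[OF assms]
      by (intro integral_le F_kernel_integrable assms) (auto intro!: mult_right_mono)
    show ?thesis
      using R
    proof
      assume "R = (\<le>)"
      then show ?thesis using Rf RK st lam
        by (auto simp: fredholm_rhs_def intro!: add_mono mult_left_mono mono)
    next
      assume "R = (\<ge>)"
      then show ?thesis using Rf RK st lam
        by (auto simp: fredholm_rhs_def intro!: add_mono mult_left_mono mono)
    qed
  qed
  then have "monotone_on I (\<le>) R (restrict (rhs \<phi>) I)"
    by (intro monotone_onI) (simp only: restrict_apply')
  moreover have "restrict (rhs \<phi>) I \<in> I \<rightarrow>\<^sub>E {0..\<kappa>}"
    using rhs_bounds[OF assms] by (intro restrict_PiE_iff[THEN iffD2]) simp
  ultimately show ?thesis
    using rhs_lsc[OF assms] unfolding F_lsc_def by blast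
qed

text \<open>The set of solutions is this small because of the maximum principle. It is applied to the
  difference of two solutions when \<open>\<lambda>\<rho>(b - a) < 1\<close>, and to a single solution in the critical case
  \<open>\<lambda>\<rho>(b - a) = 1\<close>, where \<open>f\<close> vanishes.\<close>

lemma solutions_unique_or_constants:
  "(\<forall>\<phi>\<in>solutions. \<forall>\<psi>\<in>solutions. \<phi> = \<psi>) \<or> solutions = (\<lambda>c. \<lambda>t\<in>I. c) ` {0..\<kappa>}"
proof (cases "\<kappa> = 0")
  case True
  then have zero: "\<phi> t = 0" if "\<phi> \<in> F" "t \<in> I" for \<phi> t
    using F_bounds[OF that] by simp
  have "\<phi> = \<psi>" if "\<phi> \<in> F" "\<psi> \<in> F" for \<phi> \<psi>
    using that by (rule F_eqI) (simp only: zero that)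
  then show ?thesis by (simp add: solutions_def)
next
  case False
  then have "\<kappa> > 0" using \<kappa> by simp
  have "0 \<le> \<kappa> * (1 - lam * \<rho> * (b - a))" using length_bound \<mu> by linarith
  then have q: "lam * \<rho> * (b - a) \<le> 1" using \<open>\<kappa> > 0\<close> by (simp add: zero_le_mult_iff)
  have K_abs: "\<forall>t\<in>I. \<forall>s\<in>I. \<bar>K t s\<bar> \<le> \<rho>" using K by simp
  note modulus = homogeneous_solution_constant_modulus[OF ab lam q contK K_abs]
  show ?thesis
  proof (cases "lam * \<rho> * (b - a) = 1")
    case False
    have "\<phi> = \<psi>" if "\<phi> \<in> solutions" "\<psi> \<in> solutions" for \<phi> \<psi>
    proof -
      have F: "\<phi> \<in> F" "\<psi> \<in> F" using that by (auto simp: solutions_def)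
      have eq: "\<phi> t - \<psi> t = lam * integral I (\<lambda>s. K t s * (\<phi> s - \<psi> s))" if "t \<in> I" for t
      proof -
        have "\<phi> t = rhs \<phi> t" "\<psi> t = rhs \<psi> t"
          using \<open>\<phi> \<in> solutions\<close> \<open>\<psi> \<in> solutions\<close> that by (auto simp: solutions_def)
        then have "\<phi> t - \<psi> t = rhs \<phi> t - rhs \<psi> t" by simp
        also have "\<dots> = lam * integral I (\<lambda>s. K t s * (\<phi> s - \<psi> s))"
          unfolding fredholm_rhs_def right_diff_distrib
            integral_diff[OF F_kernel_integrable[OF F(1) that] F_kernel_integrable[OF F(2) that]]
          by simp
        finally show ?thesis .
      qed
      have "(\<lambda>s. \<phi> s - \<psi> s) absolutely_integrable_on I"
        using F by (intro set_integral_diff F_absolutely_integrable)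
      then obtain M where "\<And>t. t \<in> I \<Longrightarrow> \<bar>\<phi> t - \<psi> t\<bar> = M" "M = 0"
        using modulus[of "\<lambda>s. \<phi> s - \<psi> s"] eq False by metis
      then show ?thesis using F by (intro F_eqI) auto
    qed
    then show ?thesis by blast
  next
    case True
    then have "\<mu> = 0" using length_bound \<mu> by simp
    then have f0: "f t = 0" if "t \<in> I" for t using f_bounds[OF that] by simp
    have const: "\<exists>c\<in>{0..\<kappa>}. \<phi> = (\<lambda>t\<in>I. c)" if "\<phi> \<in> solutions" for \<phi>
    proof -
      have F: "\<phi> \<in> F" using that by (simp add: solutions_def)
      have "\<phi> t = lam * integral I (\<lambda>s. K t s * \<phi> s)" if "t \<in> I" for t
        using \<open>\<phi> \<in> solutions\<close> that f0 by (simp add: solutions_def fredholm_rhs_def)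
      then obtain M where M: "\<And>t. t \<in> I \<Longrightarrow> \<bar>\<phi> t\<bar> = M"
        using modulus[OF F_absolutely_integrable[OF F]] by metis
      have M': "\<phi> t = M" if "t \<in> I" for t using M[OF that] F_bounds[OF F that] by simp
      then have "M \<in> {0..\<kappa>}" using F_bounds[OF F, of a] ab by auto
      moreover from this have "\<phi> = (\<lambda>t\<in>I. M)"
        using M' F const_in_F_lsc[OF R, of M \<kappa> I] by (intro F_eqI) auto
      ultimately show ?thesis by blast
    qed
    have rhs_const: "rhs (\<lambda>t\<in>I. c) t = c * (lam * integral I (K t))" if "t \<in> I" for c t
    proof -
      have "integral I (\<lambda>s. K t s * (\<lambda>t\<in>I. c) s) = integral I (\<lambda>s. K t s * c)"
        by (rule Henstock_Kurzweil_Integration.integral_cong) simp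
      then show ?thesis using f0[OF that] by (simp add: fredholm_rhs_def)
    qed
    show ?thesis
    proof (cases "\<exists>c\<in>{0<..\<kappa>}. (\<lambda>t\<in>I. c) \<in> solutions")
      case True
      then obtain c where c: "c > 0" "(\<lambda>t\<in>I. c) \<in> solutions" by auto
      \<comment> \<open>Cancelling \<open>c\<close> shows that the equation holds for every constant.\<close>
      have one: "lam * integral I (K t) = 1" if "t \<in> I" for t
      proof -
        have "c = rhs (\<lambda>t\<in>I. c) t" using c that by (auto simp: solutions_def)
        then show ?thesis using c rhs_const[OF that] by simp
      qed
      have "(\<lambda>t\<in>I. e) \<in> solutions" if "e \<in> {0..\<kappa>}" for e
        using that const_in_F_lsc[OF R that] rhs_const one by (simp add: solutions_def)
      then show ?thesis using const by blast
    next
      case False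
      then have "\<phi> = (\<lambda>t\<in>I. 0)" if "\<phi> \<in> solutions" for \<phi>
        using const[OF that] that by (force simp: less_le)
      then show ?thesis by blast
    qed
  qed
qed

text \<open>Restriction to \<open>I\<close> makes the right-hand side extensional, hence an element of \<open>F\<close>.\<close>

definition "fredholm_map \<phi> = restrict (rhs \<phi>) I"

lemma fredholm_map_closed: "fredholm_map \<in> carrier L \<rightarrow> carrier L"
  using rhs_in_F by (auto simp: fredholm_map_def)

lemma fredholm_map_isotone: "isotone L L fredholm_map"
  by (rule isotoneI) (auto simp: fredholm_map_def intro!: rhs_mono L.weak_partial_order_axioms)

lemma fps_fredholm_map: "fps L fredholm_map = solutions"
proof -
  have "fredholm_map \<phi> = \<phi> \<longleftrightarrow> (\<forall>t\<in>I. \<phi> t = rhs \<phi> t)" if "\<phi> \<in> F" for \<phi>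
  proof
    assume "\<forall>t\<in>I. \<phi> t = rhs \<phi> t"
    then show "fredholm_map \<phi> = \<phi>"
      using that rhs_in_F[OF that] by (intro F_eqI) (auto simp: fredholm_map_def)
  qed (metis fredholm_map_def restrict_apply')
  then show ?thesis by (auto simp: fps_def solutions_def)
qed

lemma least_solution:
  "\<exists>\<phi>. least L \<phi> solutions \<and> is_glb L \<phi> {\<phi> \<in> F. \<forall>t\<in>I. rhs \<phi> t \<le> \<phi> t}"
proof (intro exI conjI)
  have "LFP\<^bsub>L\<^esub> fredholm_map \<in> solutions"
    using L.LFP_fixed_point[OF fredholm_map_isotone fredholm_map_closed] fps_fredholm_map by simp
  moreover have "LFP\<^bsub>L\<^esub> fredholm_map \<sqsubseteq>\<^bsub>L\<^esub> \<phi>" if "\<phi> \<in> solutions" for \<phi>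
    using L.LFP_least_fixed_point[OF fredholm_map_isotone fredholm_map_closed] that fps_fredholm_map by blast
  ultimately show "least L (LFP\<^bsub>L\<^esub> fredholm_map) solutions"
    by (auto simp: least_def solutions_def)
  have "{u \<in> carrier L. fredholm_map u \<sqsubseteq>\<^bsub>L\<^esub> u} = {\<phi> \<in> F. \<forall>t\<in>I. rhs \<phi> t \<le> \<phi> t}"
    by (auto simp: fredholm_map_def)
  then show "is_glb L (LFP\<^bsub>L\<^esub> fredholm_map) {\<phi> \<in> F. \<forall>t\<in>I. rhs \<phi> t \<le> \<phi> t}"
    unfolding LEAST_FP_def using L.inf_glb[of "{\<phi> \<in> F. \<forall>t\<in>I. rhs \<phi> t \<le> \<phi> t}"] by auto
qed

lemma greatest_solution:
  "\<exists>\<phi>. greatest L \<phi> solutions \<and> is_lub L \<phi> {\<phi> \<in> F. \<forall>t\<in>I. \<phi> t \<le> rhs \<phi> t}"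
proof (intro exI conjI)
  have "GFP\<^bsub>L\<^esub> fredholm_map \<in> solutions"
    using L.GFP_fixed_point[OF fredholm_map_isotone fredholm_map_closed] fps_fredholm_map by simp
  moreover have "\<phi> \<sqsubseteq>\<^bsub>L\<^esub> GFP\<^bsub>L\<^esub> fredholm_map" if "\<phi> \<in> solutions" for \<phi>
    using L.GFP_greatest_fixed_point[OF fredholm_map_isotone fredholm_map_closed] that fps_fredholm_map by blast
  ultimately show "greatest L (GFP\<^bsub>L\<^esub> fredholm_map) solutions"
    by (auto simp: greatest_def solutions_def)
  have "{u \<in> carrier L. u \<sqsubseteq>\<^bsub>L\<^esub> fredholm_map u} = {\<phi> \<in> F. \<forall>t\<in>I. \<phi> t \<le> rhs \<phi> t}"
    by (auto simp: fredholm_map_def)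
  then show "is_lub L (GFP\<^bsub>L\<^esub> fredholm_map) {\<phi> \<in> F. \<forall>t\<in>I. \<phi> t \<le> rhs \<phi> t}"
    unfolding GREATEST_FP_def using L.sup_lub[of "{\<phi> \<in> F. \<forall>t\<in>I. \<phi> t \<le> rhs \<phi> t}"] by auto
qed

text \<open>The pointwise supremum and infimum of constant maps are again constant, hence in \<open>F\<close>, so the
  bounds in \<open>F\<close> are the numerical ones. For general families the pointwise infimum can leave \<open>F\<close>.\<close>

lemma constants_bounds:
  assumes "C \<noteq> {}" "C \<subseteq> {0..\<kappa>}"
  shows "Sup C \<in> {0..\<kappa>}" "is_lub L (\<lambda>t\<in>I. Sup C) ((\<lambda>c. \<lambda>t\<in>I. c) ` C)"
    and "Inf C \<in> {0..\<kappa>}" "is_glb L (\<lambda>t\<in>I. Inf C) ((\<lambda>c. \<lambda>t\<in>I. c) ` C)"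
proof -
  have bdd: "bdd_above C" "bdd_below C"
    using assms(2) by (meson bdd_above_Icc bdd_below_Icc bdd_above_mono bdd_below_mono)+
  obtain c where c: "c \<in> C" using assms(1) by blast
  have F: "(\<lambda>t\<in>I. c) \<in> F" if "c \<in> {0..\<kappa>}" for c by (rule const_in_F_lsc[OF R that])
  have "c \<le> Sup C" "Inf C \<le> c" using c bdd by (auto intro: cSup_upper cInf_lower)
  moreover have "Sup C \<le> \<kappa>" "0 \<le> Inf C"
    using assms by (auto intro!: cSup_least cInf_greatest)
  ultimately show SI: "Sup C \<in> {0..\<kappa>}" "Inf C \<in> {0..\<kappa>}" using c assms(2) by auto
  have CF: "(\<lambda>c. \<lambda>t\<in>I. c) ` C \<subseteq> carrier L" using F assms(2) by auto
  show "is_lub L (\<lambda>t\<in>I. Sup C) ((\<lambda>c. \<lambda>t\<in>I. c) ` C)"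
  proof (rule least_UpperI[OF _ _ CF])
    show "(\<lambda>t\<in>I. Sup C) \<sqsubseteq>\<^bsub>L\<^esub> \<psi>" if "\<psi> \<in> Upper L ((\<lambda>c. \<lambda>t\<in>I. c) ` C)" for \<psi>
    proof -
      have "c \<le> \<psi> t" if "c \<in> C" "t \<in> I" for c t
        using Upper_memD[OF \<open>\<psi> \<in> Upper L _\<close> _ CF, of "\<lambda>t\<in>I. c"] that by auto
      then show ?thesis using assms(1) by (auto intro: cSup_least)
    qed
  qed (use bdd F SI in \<open>auto intro: cSup_upper\<close>)
  show "is_glb L (\<lambda>t\<in>I. Inf C) ((\<lambda>c. \<lambda>t\<in>I. c) ` C)"
  proof (rule greatest_LowerI[OF _ _ CF])
    show "\<psi> \<sqsubseteq>\<^bsub>L\<^esub> (\<lambda>t\<in>I. Inf C)" if "\<psi> \<in> Lower L ((\<lambda>c. \<lambda>t\<in>I. c) ` C)" for \<psi>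
    proof -
      have "\<psi> t \<le> c" if "c \<in> C" "t \<in> I" for c t
        using Lower_memD[OF \<open>\<psi> \<in> Lower L _\<close> _ CF, of "\<lambda>t\<in>I. c"] that by auto
      then show ?thesis using assms(1) by (auto intro: cInf_greatest)
    qed
  qed (use bdd F SI in \<open>auto intro: cInf_lower\<close>)
qed

lemma complete_sublattice_solutions: "complete_sublattice L solutions"
  unfolding complete_sublattice_def
proof (intro conjI allI impI)
  show "lattice L" by (rule L.lattice_axioms)
  show "solutions \<noteq> {}" using least_solution by (auto simp: least_def)
  show sub: "solutions \<subseteq> carrier L" by (auto simp: solutions_def)
  fix Y assume Y: "Y \<noteq> {} \<and> Y \<subseteq> solutions"
  have "(\<exists>s\<in>solutions. is_lub L s Y) \<and> (\<exists>i\<in>solutions. is_glb L i Y)"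
    using solutions_unique_or_constants
  proof
    assume "\<forall>\<phi>\<in>solutions. \<forall>\<psi>\<in>solutions. \<phi> = \<psi>"
    then obtain \<phi> where "Y = {\<phi>}" "\<phi> \<in> solutions" using Y by blast
    moreover from this have "is_lub L \<phi> {\<phi>}" "is_glb L \<phi> {\<phi>}"
      using sub by (auto simp: least_def greatest_def Upper_def Lower_def)
    ultimately show ?thesis by blast
  next
    assume sol: "solutions = (\<lambda>c. \<lambda>t\<in>I. c) ` {0..\<kappa>}"
    then obtain C where C: "Y = (\<lambda>c. \<lambda>t\<in>I. c) ` C" "C \<subseteq> {0..\<kappa>}" "C \<noteq> {}"
      using Y by (metis image_empty subset_image_iff)
    show ?thesis
      using constants_bounds[OF C(3,2)] sol C(1) by blast
  qed
  then show "\<exists>s\<in>solutions. is_lub L s Y" "\<exists>i\<in>solutions. is_glb L i Y" by auto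
qed

end

theorem mainTheorem3:
  fixes a b lam \<kappa> \<mu> \<rho> :: real
    and K :: "real \<Rightarrow> real \<Rightarrow> real"
    and f :: "real \<Rightarrow> real"
    and I :: "real set"
    and L :: "(real \<Rightarrow> real) gorder"
  assumes "a \<le> b" and I: "I = {a..b}"
    and "lam \<ge> 0" "\<kappa> \<ge> 0" "\<mu> \<ge> 0" "\<rho> \<ge> 0"
    and "\<kappa> * (1 - lam * \<rho>) \<ge> \<mu>"
    and length_bound: "\<kappa> * (1 - lam * \<rho> * (b - a)) \<ge> \<mu>"
    and "continuous_on (I \<times> I) (\<lambda>(t, s). K t s)"
    and "\<forall>t\<in>I. \<forall>s\<in>I. 0 \<le> K t s \<and> K t s \<le> \<rho>"
    and op_or_cases:
      "(f \<in> F_lsc_op I \<mu> \<and>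
        (\<forall>s\<in>I. mono_on I (\<lambda>t. K t s)) \<and> (\<forall>t\<in>I. mono_on I (\<lambda>s. K t s)) \<and>
        L = pointwise_poset I (F_lsc_op I \<kappa>))
       \<or>
       (f \<in> F_lsc_or I \<mu> \<and>
        (\<forall>s\<in>I. antimono_on I (\<lambda>t. K t s)) \<and> (\<forall>t\<in>I. antimono_on I (\<lambda>s. K t s)) \<and>
        L = pointwise_poset I (F_lsc_or I \<kappa>))"
  shows "complete_sublattice L
           {\<phi> \<in> carrier L. \<forall>t\<in>I. \<phi> t = fredholm_rhs a b lam K f \<phi> t}
    \<and> (\<exists>\<phi>_min. least L \<phi>_min {\<phi> \<in> carrier L. \<forall>t\<in>I. \<phi> t = fredholm_rhs a b lam K f \<phi> t}
         \<and> is_glb L \<phi>_min {\<phi> \<in> carrier L. \<forall>t\<in>I. fredholm_rhs a b lam K f \<phi> t \<le> \<phi> t})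
    \<and> (\<exists>\<phi>_max. greatest L \<phi>_max {\<phi> \<in> carrier L. \<forall>t\<in>I. \<phi> t = fredholm_rhs a b lam K f \<phi> t}
         \<and> is_lub L \<phi>_max {\<phi> \<in> carrier L. \<forall>t\<in>I. \<phi> t \<le> fredholm_rhs a b lam K f \<phi> t})"
proof -
  obtain R where R: "R = (\<le>) \<or> R = (\<ge>)" and f: "f \<in> F_lsc R I \<mu>"
    and K_mono: "\<forall>s\<in>I. monotone_on I (\<le>) R (\<lambda>t. K t s)"
    and L: "L = pointwise_poset I (F_lsc R I \<kappa>)"
    using op_or_cases unfolding F_lsc_op_eq F_lsc_or_eq by blast
  interpret E: monotone_fredholm a b lam \<kappa> \<mu> \<rho> K f R
    using assms R f K_mono by unfold_locales auto
  show ?thesis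
    using E.complete_sublattice_solutions E.least_solution E.greatest_solution
    by (simp add: L I E.solutions_def)
qed

end
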